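(* Let $G$ be a connected $m$-vertex regular graph (with $m\ge 2$ finite) such that $\psi_G$ is not linear (i.e. not affine) on $[0,\log m]$. Then, for every positive integer $n$, $i_a(G^n)$ is not linear in $\log a$; that is, there are no real constants $c, C$ such that $i_a(G^n)=c\cdot\log(m^n/a)+C$ for all $a\in[m^n]$. Moreover, there are connected regular graphs $G$ for which $\psi_G$ is not linear; for example, this is the case when $G=C_m$ is the cycle with $m\ge 5$ vertices.
   Context: $\log$ is the natural logarithm and $[m]$ denotes $\{1,\dots,m\}$. For a graph $G$ and $A\subseteq V(G)$, $A^c = V(G)\setminus A$ and $e_G(A,A^c)$ is the number of edges of $G$ with exactly one endpoint in $A$. For an $m$-vertex graph $G$ and $k\in[m]$, $i_k(G) := \min\{e_G(A,A^c)/|A| : A\subseteq V(G),\ |A|=k\}$. The function $\psi_G\colon[0,\log m]\to[0,\infty)$ is the convex minorant of the points $(\log k, i_k(G))$, i.e. the largest convex function on $[0,\log m]$ satisfying $\psi_G(\log k)\le i_k(G)$ for all $k\in[m]$. $G^n$ denotes the product graph $G\square\cdots\square G$ ($n$ copies): its vertex set is $V(G)^n$ and its edges are all pairs $\{u,v\}$ for which there is an index $j\in[n]$ such that $u_jv_j\in E(G)$ and $u_l=v_l$ for all $l\neq j$. *)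

theory Defs
  imports "HOL-Analysis.Analysis" "Graph_Theory.Graph_Theory"
begin

text \<open>
  A finite simple graph is a \<^locale>\<open>pair_graph\<close>: its arc set is a finite, loop-free, symmetric
  relation, so every undirected edge \<open>{u, v}\<close> is represented by the two arcs \<open>(u, v)\<close>
  and \<open>(v, u)\<close>. Edges are therefore counted as unordered pairs.
\<close>

definition edges :: "'a pair_pre_digraph \<Rightarrow> 'a set set" where
  "edges G = {{u, v} | u v. (u, v) \<in> parcs G}"

definition cut_size :: "'a pair_pre_digraph \<Rightarrow> 'a set \<Rightarrow> nat" where
  "cut_size G A = card {e \<in> edges G. card (e \<inter> A) = 1}"

text \<open>By symmetry of the arc relation, the out-degree is the degree of the undirected graph.\<close>

definition regular :: "'a pair_pre_digraph \<Rightarrow> bool" where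
  "regular G \<longleftrightarrow> (\<exists>d. \<forall>v\<in>pverts G. out_degree (with_proj G) v = d)"

text \<open>Meaningful for \<open>1 \<le> k \<le> card (pverts G)\<close>, where the set is finite and nonempty.\<close>

definition edge_iso :: "'a pair_pre_digraph \<Rightarrow> nat \<Rightarrow> real" where
  "edge_iso G k = Min {real (cut_size G A) / real (card A) | A. A \<subseteq> pverts G \<and> card A = k}"

definition convex_below :: "'a pair_pre_digraph \<Rightarrow> (real \<Rightarrow> real) \<Rightarrow> bool" where
  "convex_below G f \<longleftrightarrow>
     convex_on {0..ln (real (card (pverts G)))} f \<and>
     (\<forall>k\<in>{1..card (pverts G)}. f (ln (real k)) \<le> edge_iso G k)"

text \<open>
  The largest convex function below the points is the pointwise supremum of all of them; the
  lemmas below confirm that this supremum is the greatest element. Only the values on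
  \<open>{0..ln (real (card (pverts G)))}\<close> are meaningful.
\<close>

definition psi :: "'a pair_pre_digraph \<Rightarrow> real \<Rightarrow> real" where
  "psi G x = (SUP f \<in> Collect (convex_below G). f x)"

definition affine_on :: "real set \<Rightarrow> (real \<Rightarrow> real) \<Rightarrow> bool" where
  "affine_on S f \<longleftrightarrow> (\<exists>c d. \<forall>x\<in>S. f x = c * x + d)"

definition graph_power :: "'a pair_pre_digraph \<Rightarrow> nat \<Rightarrow> (nat \<Rightarrow> 'a) pair_pre_digraph" where
  "graph_power G n =
     \<lparr> pverts = {1..n} \<rightarrow>\<^sub>E pverts G,
       parcs = {(u, v). u \<in> {1..n} \<rightarrow>\<^sub>E pverts G \<and> v \<in> {1..n} \<rightarrow>\<^sub>E pverts G \<and>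
         (\<exists>j\<in>{1..n}. (u j, v j) \<in> parcs G \<and> (\<forall>l\<in>{1..n} - {j}. u l = v l))} \<rparr>"

text \<open>The cycle on \<open>m\<close> vertices, for \<open>m \<ge> 3\<close>.\<close>

definition cycle_graph :: "nat \<Rightarrow> nat pair_pre_digraph" where
  "cycle_graph m =
     \<lparr> pverts = {0..<m},
       parcs = {(u, v). u < m \<and> v < m \<and> (v = (u + 1) mod m \<or> u = (v + 1) mod m)} \<rparr>"

lemma edge_iso_nonneg:
  assumes "finite (pverts G)" "k \<in> {1..card (pverts G)}"
  shows "0 \<le> edge_iso G k"
proof -
  let ?S = "{real (cut_size G A) / real (card A) | A. A \<subseteq> pverts G \<and> card A = k}"
  have "?S = (\<lambda>A. real (cut_size G A) / real (card A)) ` {A. A \<subseteq> pverts G \<and> card A = k}"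
    by auto
  then have "finite ?S" using assms(1) by simp
  moreover obtain B where "B \<subseteq> pverts G" "card B = k"
    using assms(2) by (meson atLeastAtMost_iff obtain_subset_with_card_n)
  then have "?S \<noteq> {}" by blast
  ultimately have "Min ?S \<in> ?S" by (rule Min_in)
  then show ?thesis unfolding edge_iso_def by auto
qed

context
  fixes G :: "'a pair_pre_digraph"
  assumes fin: "finite (pverts G)" and ne: "pverts G \<noteq> {}"
begin

lemma convex_below_zero: "convex_below G (\<lambda>_. 0)"
  unfolding convex_below_def using edge_iso_nonneg[OF fin] by (auto simp: convex_on_const)

private lemma card_pos: "1 \<le> card (pverts G)"
  using fin ne by (simp add: Suc_leI card_gt_0_iff)

lemma convex_below_bounded:
  assumes "convex_below G f" "x \<in> {0..ln (real (card (pverts G)))}"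
  shows "f x \<le> max (edge_iso G 1) (edge_iso G (card (pverts G)))"
proof -
  have cv: "convex_on {0..ln (real (card (pverts G)))} f" and le: "\<forall>k\<in>{1..card (pverts G)}. f (ln (real k)) \<le> edge_iso G k"
    using assms(1) by (auto simp: convex_below_def)
  define L where "L = ln (real (card (pverts G)))"
  have x: "x \<in> {0..L}" and cvL: "convex_on {0..L} f"
    using assms(2) cv by (simp_all add: L_def)
  have "f 0 \<le> edge_iso G 1" "f L \<le> edge_iso G (card (pverts G))"
    using le[rule_format, of 1] le[rule_format, of "card (pverts G)"] card_pos by (auto simp: L_def)
  moreover have "f x \<le> max (f 0) (f L)"
  proof (cases "L = 0")
    case True
    then show ?thesis using x by auto
  next
    case False
    then have L: "L > 0" using x by auto
    define v where "v = x / L"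
    have v: "0 \<le> v" "v \<le> 1" "x = v * L"
      using x L by (auto simp: v_def)
    have "f ((1 - v) *\<^sub>R 0 + v *\<^sub>R L) \<le> (1 - v) * f 0 + v * f L"
      using cvL v L by (intro convex_onD) auto
    then have "f x \<le> (1 - v) * f 0 + v * f L" using v(3) by simp
    also have "\<dots> \<le> (1 - v) * max (f 0) (f L) + v * max (f 0) (f L)"
      using v by (intro add_mono mult_left_mono) auto
    finally show ?thesis by (simp add: algebra_simps)
  qed
  ultimately show ?thesis by linarith
qed

private lemma bdd: "x \<in> {0..ln (real (card (pverts G)))} \<Longrightarrow> bdd_above ((\<lambda>f. f x) ` Collect (convex_below G))"
  using convex_below_bounded by (intro bdd_aboveI2) auto

lemma psi_greatest: "convex_below G f \<Longrightarrow> x \<in> {0..ln (real (card (pverts G)))} \<Longrightarrow> f x \<le> psi G x"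
  unfolding psi_def using bdd by (intro cSUP_upper) auto

lemma psi_least: "(\<And>f. convex_below G f \<Longrightarrow> f x \<le> b) \<Longrightarrow> psi G x \<le> b"
  unfolding psi_def using convex_below_zero by (intro cSUP_least) auto

lemma psi_nonneg: "x \<in> {0..ln (real (card (pverts G)))} \<Longrightarrow> 0 \<le> psi G x"
  using psi_greatest[OF convex_below_zero] .

lemma convex_below_psi: "convex_below G (psi G)"
  unfolding convex_below_def
proof (intro conjI ballI)
  show "convex_on {0..ln (real (card (pverts G)))} (psi G)"
    unfolding convex_on_def
  proof (intro conjI ballI allI impI)
    show "convex {0..ln (real (card (pverts G)))}" by simp
  next
    fix x y u v :: real
    assume *: "x \<in> {0..ln (real (card (pverts G)))}" "y \<in> {0..ln (real (card (pverts G)))}" "0 \<le> u" "0 \<le> v" "u + v = 1"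
    show "psi G (u *\<^sub>R x + v *\<^sub>R y) \<le> u * psi G x + v * psi G y"
    proof (rule psi_least)
      fix f assume f: "convex_below G f"
      then have "f (u *\<^sub>R x + v *\<^sub>R y) \<le> u * f x + v * f y"
        using * by (auto simp: convex_below_def convex_on_def)
      also have "\<dots> \<le> u * psi G x + v * psi G y"
        using * f by (intro add_mono mult_left_mono psi_greatest) auto
      finally show "f (u *\<^sub>R x + v *\<^sub>R y) \<le> u * psi G x + v * psi G y" .
    qed
  qed
next
  fix k assume "k \<in> {1..card (pverts G)}"
  then show "psi G (ln (real k)) \<le> edge_iso G k"
    by (intro psi_least) (auto simp: convex_below_def)
qed

end

end

theory Submission
  imports Defs
begin

text \<open>
  Let \<open>d\<close> be the degree of \<open>G\<close>. A formula \<open>c log (m\<^sup>n / a) + C\<close> for \<open>i\<^sub>a(G\<^sup>n)\<close> is determined by its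
  values \<open>0\<close> at \<open>a = m\<^sup>n\<close> and \<open>n d\<close> at \<open>a = 1\<close>, so \<open>C = 0\<close> and \<open>c = d / log m\<close>. If \<open>\<psi>\<^sub>G\<close> is not
  affine, then some point \<open>(log k, i\<^sub>k(G))\<close> lies strictly below the chord from \<open>(0, d)\<close> to
  \<open>(log m, 0)\<close>. Taking the product of an optimal \<open>k\<close>-set with \<open>n - 1\<close> full factors shows that
  \<open>i\<^sub>a(G\<^sup>n) \<le> i\<^sub>k(G)\<close> for \<open>a = k m\<^sup>n\<^sup>-\<^sup>1\<close>, which is strictly below the forced value
  \<open>d (1 - log k / log m)\<close>. For the cycle, a pair of adjacent vertices gives such a point at \<open>k = 2\<close>
  as soon as \<open>m > 4\<close>.
\<close>

section \<open>Cuts, and the values of the isoperimetric profile at its two ends\<close>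

lemma edge_iso_le:
  assumes "finite (pverts G)" "A \<subseteq> pverts G"
  shows "edge_iso G (card A) \<le> real (cut_size G A) / real (card A)"
proof -
  have "{real (cut_size G B) / real (card B) | B. B \<subseteq> pverts G \<and> card B = card A}
      = (\<lambda>B. real (cut_size G B) / real (card B)) ` {B. B \<subseteq> pverts G \<and> card B = card A}"
    by (rule setcompr_eq_image)
  then show ?thesis unfolding edge_iso_def using assms by (intro Min_le) auto
qed

lemma edge_iso_attained:
  assumes "finite (pverts G)" "k \<in> {1..card (pverts G)}"
  obtains A where "A \<subseteq> pverts G" "card A = k" "edge_iso G k = real (cut_size G A) / real k"
proof -
  let ?S = "{real (cut_size G A) / real (card A) | A. A \<subseteq> pverts G \<and> card A = k}"
  have "?S = (\<lambda>A. real (cut_size G A) / real (card A)) ` {A. A \<subseteq> pverts G \<and> card A = k}"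
    by (rule setcompr_eq_image)
  then have "finite ?S" using assms(1) by simp
  moreover obtain B where "B \<subseteq> pverts G" "card B = k"
    using assms(2) by (meson atLeastAtMost_iff obtain_subset_with_card_n)
  then have "?S \<noteq> {}" by blast
  ultimately have "Min ?S \<in> ?S" by (rule Min_in)
  then show thesis using that unfolding edge_iso_def by auto
qed

text \<open>Finitely many vertices already force finitely many arcs, so only looplessness, symmetry
  and membership of endpoints remain to be checked for products and cycles.\<close>

lemma pair_graphI:
  assumes "finite (pverts G)" "\<And>u v. (u, v) \<in> parcs G \<Longrightarrow> u \<in> pverts G \<and> u \<noteq> v \<and> (v, u) \<in> parcs G"
  shows "pair_graph G"
proof -
  have "parcs G \<subseteq> pverts G \<times> pverts G" using assms(2) by (metis mem_Sigma_iff subrelI)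
  then have "finite (parcs G)" using assms(1) by (meson finite_SigmaI finite_subset)
  then show ?thesis
    using assms by unfold_locales (auto simp: symmetric_def sym_def dest: assms(2))
qed

lemma card_doubleton_Int_eq_1_iff:
  "card ({u, v} \<inter> A) = 1 \<longleftrightarrow> (u = v \<and> u \<in> A) \<or> (u \<in> A) \<noteq> (v \<in> A)"
  by (cases "u \<in> A"; cases "v \<in> A") (auto simp: card_insert_if)

lemma cut_edges_eq:
  assumes "pair_graph G"
  shows "{e \<in> edges G. card (e \<inter> A) = 1} = {{u, v} | u v. (u, v) \<in> parcs G \<and> u \<in> A \<and> v \<notin> A}"
proof -
  interpret pair_graph G by fact
  have sym: "(v, u) \<in> parcs G" if "(u, v) \<in> parcs G" for u v
    using that pair_sym_arcs by (auto simp: symmetric_def sym_def)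
  have irr: "u \<noteq> v" if "(u, v) \<in> parcs G" for u v
    using pair_no_loops[OF that] by simp
  show ?thesis
  proof (intro equalityI subsetI)
    fix e assume "e \<in> {e \<in> edges G. card (e \<inter> A) = 1}"
    then obtain u v where uv: "e = {u, v}" "(u, v) \<in> parcs G" "card ({u, v} \<inter> A) = 1"
      unfolding edges_def by auto
    then have "(u \<in> A) \<noteq> (v \<in> A)"
      using irr card_doubleton_Int_eq_1_iff by metis
    then show "e \<in> {{u, v} | u v. (u, v) \<in> parcs G \<and> u \<in> A \<and> v \<notin> A}"
      using uv sym by (cases "u \<in> A") (auto simp: insert_commute)
  next
    fix e assume "e \<in> {{u, v} | u v. (u, v) \<in> parcs G \<and> u \<in> A \<and> v \<notin> A}"
    then obtain u v where "e = {u, v}" "(u, v) \<in> parcs G" "u \<in> A" "v \<notin> A" by auto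
    then show "e \<in> {e \<in> edges G. card (e \<inter> A) = 1}"
      unfolding edges_def by (auto simp: card_doubleton_Int_eq_1_iff)
  qed
qed

text \<open>Of the two arcs representing a cut edge exactly one leaves \<open>A\<close>, so
  forgetting orientation is injective on leaving arcs and no factor 2 appears. All later cuts are
  counted through arcs.\<close>

lemma cut_size_eq_card_arcs:
  assumes "pair_graph G"
  shows "cut_size G A = card {(u, v) \<in> parcs G. u \<in> A \<and> v \<notin> A}"
proof -
  have "{e \<in> edges G. card (e \<inter> A) = 1} = (\<lambda>(u, v). {u, v}) ` {(u, v) \<in> parcs G. u \<in> A \<and> v \<notin> A}"
    unfolding cut_edges_eq[OF assms] by auto
  moreover have "inj_on (\<lambda>(u, v). {u, v}) {(u, v) \<in> parcs G. u \<in> A \<and> v \<notin> A}"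
    by (auto simp: inj_on_def doubleton_eq_iff)
  ultimately show ?thesis unfolding cut_size_def by (simp add: card_image)
qed

lemma cut_size_pverts:
  assumes "pair_graph G"
  shows "cut_size G (pverts G) = 0"
proof -
  interpret pair_graph G by fact
  have "{(u, v) \<in> parcs G. u \<in> pverts G \<and> v \<notin> pverts G} = {}"
    using in_arcsD2 by auto
  then show ?thesis unfolding cut_size_eq_card_arcs[OF assms] by (simp only: card.empty)
qed

lemma edge_iso_card_pverts:
  assumes "pair_graph G"
  shows "edge_iso G (card (pverts G)) = 0"
proof -
  interpret pair_graph G by fact
  have "{A. A \<subseteq> pverts G \<and> card A = card (pverts G)} = {pverts G}"
    using card_subset_eq pair_finite_verts by blast
  then have "{real (cut_size G A) / real (card A) | A. A \<subseteq> pverts G \<and> card A = card (pverts G)} = {0}"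
    unfolding setcompr_eq_image by (simp add: cut_size_pverts[OF assms])
  then show ?thesis unfolding edge_iso_def by simp
qed

text \<open>Without loops, every arc starting at \<open>v\<close> leaves \<open>{v}\<close>.\<close>

lemma cut_size_singleton:
  assumes "pair_graph G"
  shows "cut_size G {v} = out_degree (with_proj G) v"
proof -
  interpret pair_graph G by fact
  have "{(u, w) \<in> parcs G. u \<in> {v} \<and> w \<notin> {v}} = out_arcs (with_proj G) v"
    using pair_no_loops by (fastforce simp: out_arcs_def)
  then show ?thesis unfolding cut_size_eq_card_arcs[OF assms] out_degree_def by simp
qed

lemma edge_iso_1:
  assumes "pair_graph G" "pverts G \<noteq> {}" "\<And>v. v \<in> pverts G \<Longrightarrow> out_degree (with_proj G) v = d"
  shows "edge_iso G 1 = real d"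
proof -
  interpret pair_graph G by fact
  have "1 \<in> {1..card (pverts G)}"
    using assms(2) pair_finite_verts by (simp add: Suc_leI card_gt_0_iff)
  then obtain A where A: "A \<subseteq> pverts G" "card A = 1" "edge_iso G 1 = real (cut_size G A) / real 1"
    using edge_iso_attained pair_finite_verts by blast
  then obtain v where "A = {v}" using card_1_singletonE by blast
  then show ?thesis using A cut_size_singleton[OF assms(1), of v] assms(3)[of v] by simp
qed

section \<open>The convex minorant compared with the chord\<close>

lemma convex_on_affine: "convex S \<Longrightarrow> convex_on S (\<lambda>x::real. c * x + d)"
  unfolding convex_on_def
proof clarsimp
  fix x y u v :: real
  assume "u + v = 1"
  then have "d = u * d + v * d" by (metis distrib_right mult_1)
  then show "c * (u * x + v * y) + d \<le> u * (c * x + d) + v * (c * y + d)"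
    by (simp add: algebra_simps)
qed

text \<open>The chord from \<open>(0, d)\<close> to \<open>(ln m, 0)\<close> is convex and below all
  the points, hence below \<open>psi G\<close>. Conversely \<open>psi G\<close> is convex and at
  most the chord at both ends, hence below the chord throughout. The contrapositive yields a point
  strictly below the chord.\<close>

lemma affine_on_psi:
  assumes "pair_graph G" and m: "card (pverts G) = m" "m \<ge> 2"
    and d: "edge_iso G 1 = d"
    and above: "\<And>k. k \<in> {1..m} \<Longrightarrow> d * (1 - ln (real k) / ln (real m)) \<le> edge_iso G k"
  shows "affine_on {0..ln (real m)} (psi G)"
proof -
  interpret pair_graph G by fact
  note fin = pair_finite_verts
  have ne: "pverts G \<noteq> {}" using m by auto
  define L where "L = ln (real m)"
  have L: "L > 0" using m by (simp add: L_def)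
  have chord_below: "convex_below G (\<lambda>x. - (d / L) * x + d)"
    unfolding convex_below_def m(1)
    using above L by (intro conjI convex_on_affine ballI) (auto simp: L_def field_simps)
  have below: "convex_below G (psi G)" by (rule convex_below_psi[OF fin ne])
  then have cv: "convex_on {0..L} (psi G)" by (simp add: convex_below_def m L_def)
  have "psi G (ln (real 1)) \<le> d" "psi G (ln (real m)) \<le> edge_iso G m"
    using below d m unfolding convex_below_def by (auto dest: bspec[of _ _ 1])
  then have ends: "psi G 0 \<le> d" "psi G L \<le> 0"
    using edge_iso_card_pverts[OF assms(1)] m by (auto simp: L_def)
  have "psi G x = - (d / L) * x + d" if x: "x \<in> {0..L}" for x
  proof (rule antisym)
    define t where "t = x / L"
    have t: "0 \<le> t" "t \<le> 1" "x = t * L" using x L by (auto simp: t_def)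
    have "psi G ((1 - t) *\<^sub>R 0 + t *\<^sub>R L) \<le> (1 - t) * psi G 0 + t * psi G L"
      using convex_onD[OF cv, of t 0 L] t L by simp
    also have "\<dots> \<le> (1 - t) * d + t * 0"
      using t ends by (intro add_mono mult_left_mono) auto
    finally show "psi G x \<le> - (d / L) * x + d" using t L by (simp add: algebra_simps)
    show "- (d / L) * x + d \<le> psi G x"
      using psi_greatest[OF fin ne chord_below] x m by (simp add: L_def)
  qed
  then show ?thesis unfolding affine_on_def L_def by blast
qed

text \<open>The leftmost point is isolated: all others have abscissa at least log 2, so a steep
  enough line through it is a minorant. This fixes the constant term of an affine
  \<open>psi G\<close> in \<open>not_affine_on_psi\<close>.\<close>

lemma psi_0:
  assumes "pair_graph G" "card (pverts G) \<ge> 1"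
  shows "psi G 0 = edge_iso G 1"
proof (rule antisym)
  interpret pair_graph G by fact
  note fin = pair_finite_verts
  have ne: "pverts G \<noteq> {}" using assms by auto
  show "psi G 0 \<le> edge_iso G 1"
    using convex_below_psi[OF fin ne] assms(2) unfolding convex_below_def by (auto dest: bspec[of _ _ 1])
  define d where "d = edge_iso G 1"
  \<comment> \<open>The line of value \<open>d\<close> at \<open>0\<close> that vanishes at \<open>log 2\<close> lies below all the points.\<close>
  have d: "0 \<le> d" unfolding d_def using assms(2) by (intro edge_iso_nonneg[OF fin]) auto
  have "convex_below G (\<lambda>x. - (d / ln 2) * x + d)"
    unfolding convex_below_def
  proof (intro conjI convex_on_affine ballI)
    fix k assume k: "k \<in> {1..card (pverts G)}"
    show "- (d / ln 2) * ln (real k) + d \<le> edge_iso G k"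
    proof (cases "k = 1")
      case False
      then have "ln 2 \<le> ln (real k)" using k by (subst ln_le_cancel_iff) auto
      then have "- (d / ln 2) * ln (real k) + d \<le> 0"
        using d mult_left_mono[of "ln 2" "ln (real k)" d] by (simp add: field_simps)
      also have "\<dots> \<le> edge_iso G k" by (rule edge_iso_nonneg[OF fin k])
      finally show ?thesis .
    qed (simp add: d_def)
  qed simp
  from psi_greatest[OF fin ne this, of 0] show "edge_iso G 1 \<le> psi G 0"
    using assms(2) by (simp add: d_def)
qed

text \<open>An affine \<open>psi G\<close> would equal \<open>edge_iso G 1\<close> at 0 and be
  nonnegative at \<open>ln m\<close>, hence dominate the chord. A point strictly below the chord
  would then lie below its own minorant.\<close>

lemma not_affine_on_psi:
  assumes "pair_graph G" and m: "card (pverts G) = m" and k: "k \<in> {1..m}" "m \<ge> 2"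
    and less: "edge_iso G k < edge_iso G 1 * (1 - ln (real k) / ln (real m))"
  shows "\<not> affine_on {0..ln (real m)} (psi G)"
proof
  interpret pair_graph G by fact
  note fin = pair_finite_verts
  have ne: "pverts G \<noteq> {}" using k m by auto
  have L: "ln (real m) > 0" and lnk: "0 \<le> ln (real k)" "ln (real k) \<le> ln (real m)" using k by auto
  assume "affine_on {0..ln (real m)} (psi G)"
  then obtain c b where cb: "\<And>x. x \<in> {0..ln (real m)} \<Longrightarrow> psi G x = c * x + b"
    unfolding affine_on_def by blast
  have b: "b = edge_iso G 1" using cb[of 0] L psi_0[OF assms(1)] m k by simp
  have "0 \<le> c * ln (real m) + b"
    using psi_nonneg[OF fin ne, of "ln (real m)"] cb[of "ln (real m)"] L m by simp
  then have "- b / ln (real m) \<le> c" using L by (simp add: field_simps)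
  then have "- b / ln (real m) * ln (real k) \<le> c * ln (real k)" using lnk by (intro mult_right_mono)
  then have "edge_iso G 1 * (1 - ln (real k) / ln (real m)) \<le> psi G (ln (real k))"
    using cb[of "ln (real k)"] lnk b by (simp add: algebra_simps)
  also have "\<dots> \<le> edge_iso G k"
    using convex_below_psi[OF fin ne] k m unfolding convex_below_def by auto
  finally show False using less by simp
qed

section \<open>Product graphs: arcs, degrees and an upper bound on the profile\<close>

lemma pair_graph_graph_power:
  assumes "pair_graph G"
  shows "pair_graph (graph_power G n)"
proof (rule pair_graphI)
  interpret pair_graph G by fact
  show "finite (pverts (graph_power G n))"
    unfolding graph_power_def using pair_finite_verts by (auto intro: finite_PiE)
  have sym: "(y, x) \<in> parcs G" if "(x, y) \<in> parcs G" for x y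
    using that pair_sym_arcs by (auto simp: symmetric_def sym_def)
  have irr: "x \<noteq> y" if "(x, y) \<in> parcs G" for x y
    using pair_no_loops[OF that] by simp
  show "u \<in> pverts (graph_power G n) \<and> u \<noteq> v \<and> (v, u) \<in> parcs (graph_power G n)"
    if uv: "(u, v) \<in> parcs (graph_power G n)" for u v
  proof -
    obtain j where "u \<in> {1..n} \<rightarrow>\<^sub>E pverts G" "v \<in> {1..n} \<rightarrow>\<^sub>E pverts G" "j \<in> {1..n}"
      "(u j, v j) \<in> parcs G" "\<forall>l\<in>{1..n} - {j}. u l = v l"
      using uv unfolding graph_power_def by auto
    moreover from this have "(v j, u j) \<in> parcs G" "\<forall>l\<in>{1..n} - {j}. v l = u l" "u \<noteq> v"
      using sym irr[of "u j" "v j"] by auto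
    ultimately show ?thesis unfolding graph_power_def by auto
  qed
qed

text \<open>Expressing the head of an arc as an update of its tail makes a neighbour the same thing
  as a choice of coordinate and new value, which is the form used for counting.\<close>

lemma graph_power_arc_iff:
  assumes "pair_graph G"
  shows "(u, v) \<in> parcs (graph_power G n) \<longleftrightarrow> u \<in> {1..n} \<rightarrow>\<^sub>E pverts G \<and>
    (\<exists>j\<in>{1..n}. \<exists>w. (u j, w) \<in> parcs G \<and> v = u(j := w))"
proof -
  interpret pair_graph G by fact
  show ?thesis
  proof
    assume "(u, v) \<in> parcs (graph_power G n)"
    then obtain j where j: "u \<in> {1..n} \<rightarrow>\<^sub>E pverts G" "v \<in> {1..n} \<rightarrow>\<^sub>E pverts G" "j \<in> {1..n}"
      "(u j, v j) \<in> parcs G" "\<forall>l\<in>{1..n} - {j}. u l = v l"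
      unfolding graph_power_def by auto
    \<comment> \<open>Equality of functions is also needed off \<open>{1..n}\<close>; there both
      sides are \<open>undefined\<close> by extensionality.\<close>
    have "v l = (u(j := v j)) l" for l
      using j PiE_arb[OF j(1), of l] PiE_arb[OF j(2), of l] by (cases "l \<in> {1..n}") auto
    then show "u \<in> {1..n} \<rightarrow>\<^sub>E pverts G \<and> (\<exists>j\<in>{1..n}. \<exists>w. (u j, w) \<in> parcs G \<and> v = u(j := w))"
      using j by blast
  next
    assume "u \<in> {1..n} \<rightarrow>\<^sub>E pverts G \<and> (\<exists>j\<in>{1..n}. \<exists>w. (u j, w) \<in> parcs G \<and> v = u(j := w))"
    then obtain j w where j: "u \<in> {1..n} \<rightarrow>\<^sub>E pverts G" "j \<in> {1..n}" "(u j, w) \<in> parcs G" "v = u(j := w)"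
      by blast
    then have "v \<in> {1..n} \<rightarrow>\<^sub>E pverts G"
      using in_arcsD2[OF j(3)] by (auto simp: PiE_iff extensional_def)
    then show "(u, v) \<in> parcs (graph_power G n)"
      using j unfolding graph_power_def by (auto intro!: bexI[of _ j])
  qed
qed

text \<open>Out-arcs at \<open>u\<close> biject with pairs of a coordinate \<open>j\<close> and a
  neighbour of \<open>u j\<close>, giving \<open>d\<close> arcs for each of \<open>n\<close>
  coordinates.\<close>

lemma out_degree_graph_power:
  assumes "pair_graph G" and deg: "\<And>v. v \<in> pverts G \<Longrightarrow> out_degree (with_proj G) v = d"
    and u: "u \<in> pverts (graph_power G n)"
  shows "out_degree (with_proj (graph_power G n)) u = n * d"
proof -
  interpret pair_graph G by fact
  have u: "u \<in> {1..n} \<rightarrow>\<^sub>E pverts G" using u by (simp add: graph_power_def)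
  define N where "N j = {w. (u j, w) \<in> parcs G}" for j
  have "out_arcs (with_proj G) (u j) = Pair (u j) ` N j" for j
    unfolding N_def out_arcs_def by auto
  then have N: "card (N j) = d" if "j \<in> {1..n}" for j
    using deg[of "u j"] u that by (auto simp: out_degree_def card_image inj_on_def PiE_iff)
  have finN: "finite (N j)" for j
    by (rule finite_subset[OF _ pair_finite_verts]) (auto simp: N_def dest: in_arcsD2)
  have "out_arcs (with_proj (graph_power G n)) u
      = (\<lambda>(j, w). (u, u(j := w))) ` (SIGMA j:{1..n}. N j)"
    using u unfolding out_arcs_def N_def
    by (force simp: graph_power_arc_iff[OF assms(1)] image_iff)
  moreover have "inj_on (\<lambda>(j, w). (u, u(j := w))) (SIGMA j:{1..n}. N j)"
  proof (rule inj_onI, clarsimp)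
    fix j w j' w' assume *: "w \<in> N j" "w' \<in> N j'" "u(j := w) = u(j' := w')"
    \<comment> \<open>Looplessness makes \<open>j\<close> recoverable as the only place where the
      updated function differs from \<open>u\<close>.\<close>
    have "w \<noteq> u j" using * pair_no_loops unfolding N_def by fastforce
    then show "j = j' \<and> w = w'" using * by (metis fun_upd_apply)
  qed
  ultimately have "out_degree (with_proj (graph_power G n)) u = card (SIGMA j:{1..n}. N j)"
    unfolding out_degree_def by (simp add: card_image)
  also have "\<dots> = n * d" using N finN by simp
  finally show ?thesis .
qed

lemma card_pverts_graph_power: "card (pverts (graph_power G n)) = card (pverts G) ^ n"
  unfolding graph_power_def by (simp add: card_PiE)

text \<open>For \<open>B\<close>, an optimal \<open>A\<close> in the first coordinate and all of
  \<open>G\<close> in the others, a leaving arc is determined by an arc of \<open>G\<close> leaving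
  \<open>A\<close> and the other \<open>n - 1\<close> coordinates. The factor
  \<open>m ^ (n - 1)\<close> then cancels between cut and size.\<close>

lemma edge_iso_graph_power_le:
  assumes "pair_graph G" "n \<ge> 1" "k \<in> {1..card (pverts G)}"
  shows "edge_iso (graph_power G n) (k * card (pverts G) ^ (n - 1)) \<le> edge_iso G k"
proof -
  interpret pair_graph G by fact
  interpret P: pair_graph "graph_power G n" by (rule pair_graph_graph_power[OF assms(1)])
  define m where "m = card (pverts G)"
  obtain A where A: "A \<subseteq> pverts G" "card A = k" "edge_iso G k = real (cut_size G A) / real k"
    using edge_iso_attained[OF pair_finite_verts assms(3)] .
  define B where "B = (\<Pi>\<^sub>E i\<in>{1..n}. if i = 1 then A else pverts G)"
  define R where "R = {2..n} \<rightarrow>\<^sub>E pverts G"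
  have split: "{1..n} = insert 1 {2..n}" using assms(2) by auto
  have card_B: "card B = k * m ^ (n - 1)"
    unfolding B_def split using A by (simp add: card_PiE m_def)
  have card_R: "card R = m ^ (n - 1)" and finR: "finite R"
    unfolding R_def by (auto simp: card_PiE m_def pair_finite_verts finite_PiE)
  define C where "C = {(x, y) \<in> parcs G. x \<in> A \<and> y \<notin> A}"
  have finC: "finite C"
    unfolding C_def by (rule finite_subset[OF _ pair_finite_arcs]) auto
  have "{(u, v) \<in> parcs (graph_power G n). u \<in> B \<and> v \<notin> B}
      \<subseteq> (\<lambda>((x, y), r). (r(1 := x), r(1 := y))) ` (C \<times> R)"
  proof clarify
    fix u v assume uv: "(u, v) \<in> parcs (graph_power G n)" "u \<in> B" "v \<notin> B"
    then obtain j w where j: "u \<in> {1..n} \<rightarrow>\<^sub>E pverts G" "j \<in> {1..n}" "(u j, w) \<in> parcs G" "v = u(j := w)"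
      unfolding graph_power_arc_iff[OF assms(1)] by blast
    have w: "w \<in> pverts G" using in_arcsD2[OF j(3)] .
    \<comment> \<open>A change in another coordinate, or a change of the first one within
      \<open>A\<close>, stays inside \<open>B\<close>.\<close>
    have j1: "j = 1 \<and> w \<notin> A"
    proof (rule ccontr)
      assume "\<not> (j = 1 \<and> w \<notin> A)"
      then have "v i \<in> (if i = 1 then A else pverts G)" if "i \<in> {1..n}" for i
        using PiE_mem[OF uv(2)[unfolded B_def] that] j(4) w by (cases "i = j") auto
      moreover have "v i = undefined" if "i \<notin> {1..n}" for i
        using PiE_arb[OF j(1) that] j that by auto
      ultimately have "v \<in> B" unfolding B_def by (intro PiE_I)
      then show False using uv(3) by simp
    qed
    have "u 1 \<in> A" using uv(2) assms(2) unfolding B_def by (auto dest: PiE_mem[of _ _ _ 1])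
    then have "(u 1, w) \<in> C" using j j1 unfolding C_def by simp
    \<comment> \<open>Members of \<open>R\<close> must be \<open>undefined\<close> at 1, so the
      first entry is blanked; writing \<open>u 1\<close> or \<open>w\<close> back restores the two
      endpoints.\<close>
    moreover have "u(1 := undefined) \<in> R"
      using j(1) unfolding R_def by (auto simp: PiE_iff extensional_def)
    ultimately show "(u, v) \<in> (\<lambda>((x, y), r). (r(1 := x), r(1 := y))) ` (C \<times> R)"
      using j j1 by (intro image_eqI[of _ _ "((u 1, w), u(1 := undefined))"]) auto
  qed
  then have "cut_size (graph_power G n) B \<le> card ((\<lambda>((x, y), r). (r(1 := x), r(1 := y))) ` (C \<times> R))"
    unfolding cut_size_eq_card_arcs[OF P.pair_graph_axioms]
    using finC finR by (intro card_mono) auto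
  also have "\<dots> \<le> card (C \<times> R)" using finC finR by (intro card_image_le) auto
  also have "\<dots> = cut_size G A * m ^ (n - 1)"
    unfolding card_cartesian_product card_R C_def cut_size_eq_card_arcs[OF assms(1)] ..
  finally have cut: "cut_size (graph_power G n) B \<le> cut_size G A * m ^ (n - 1)" .
  have "B \<subseteq> pverts (graph_power G n)"
    unfolding B_def graph_power_def pair_pre_digraph.simps using A(1) by (intro PiE_mono) simp
  from edge_iso_le[OF P.pair_finite_verts this]
  have "edge_iso (graph_power G n) (k * m ^ (n - 1)) \<le> real (cut_size (graph_power G n) B) / real (k * m ^ (n - 1))"
    unfolding card_B .
  also have "\<dots> \<le> real (cut_size G A * m ^ (n - 1)) / real (k * m ^ (n - 1))"
    using cut by (intro divide_right_mono of_nat_mono) auto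
  also have "\<dots> = edge_iso G k"
    using A(3) assms(3) unfolding m_def by auto
  finally show ?thesis unfolding m_def .
qed

section \<open>Contradiction with a linear profile of the product\<close>

lemma edge_iso_graph_power_not_linear:
  assumes "pair_graph G" "regular G" and m: "card (pverts G) = m" "m \<ge> 2"
    and naff: "\<not> affine_on {0..ln (real m)} (psi G)" and n: "n \<ge> 1"
    and lin: "\<And>a. a \<in> {1..m ^ n} \<Longrightarrow> edge_iso (graph_power G n) a = c * ln (real (m ^ n) / real a) + b"
  shows False
proof -
  interpret pair_graph G by fact
  note P = pair_graph_graph_power[OF assms(1), of n]
  obtain d where deg: "\<And>v. v \<in> pverts G \<Longrightarrow> out_degree (with_proj G) v = d"
    using assms(2) unfolding regular_def by blast
  have L: "ln (real m) > 0" using m by simp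
  have i1: "edge_iso G 1 = real d"
    using m deg by (intro edge_iso_1[OF assms(1)]) auto
  \<comment> \<open>If no such \<open>k\<close> existed, \<open>affine_on_psi\<close> would
    apply.\<close>
  obtain k where k: "k \<in> {1..m}" "edge_iso G k < d * (1 - ln (real k) / ln (real m))"
    using affine_on_psi[OF assms(1) m i1] naff by force
  have "edge_iso (graph_power G n) (m ^ n) = 0"
    using edge_iso_card_pverts[OF P] by (simp add: card_pverts_graph_power m)
  then have b: "b = 0" using lin[of "m ^ n"] m by simp
  have "pverts (graph_power G n) \<noteq> {}"
    using card_pverts_graph_power[of G n] m by auto
  then have "edge_iso (graph_power G n) 1 = real (n * d)"
    using out_degree_graph_power[OF assms(1) deg] by (intro edge_iso_1[OF P]) auto
  \<comment> \<open>At \<open>a = 1\<close> both the degree \<open>n * d\<close> and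
    \<open>ln (m ^ n)\<close> carry a factor \<open>n\<close>, so the slope found next does not
    depend on \<open>n\<close>.\<close>
  then have "real n * real d = real n * (c * ln (real m))"
    using lin[of 1] m b by (simp add: ln_realpow)
  then have c: "c = d / ln (real m)" using n L by (simp add: field_simps)
  \<comment> \<open>With this splitting, \<open>m ^ n / (k * m ^ (n - 1))\<close> reduces to
    \<open>m / k\<close>.\<close>
  have mn: "m ^ n = m * m ^ (n - 1)" using n by (cases n) auto
  have "k * m ^ (n - 1) \<in> {1..m ^ n}" using k m unfolding mn by auto
  from lin[OF this] have "edge_iso (graph_power G n) (k * m ^ (n - 1)) = c * ln (real m / real k)"
    using m b unfolding mn by simp
  also have "\<dots> = d * (1 - ln (real k) / ln (real m))"
    using k m L unfolding c by (simp add: ln_div field_simps)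
  finally show False
    using edge_iso_graph_power_le[OF assms(1) n, of k] k m by simp
qed

section \<open>Cycles with at least five vertices\<close>

text \<open>Replaces \<open>mod\<close> by an explicit wrap-around case, leaving linear arithmetic
  for the lemmas on cycles.\<close>

lemma cycle_graph_arc_iff:
  assumes "m \<ge> 3"
  shows "(u, v) \<in> parcs (cycle_graph m) \<longleftrightarrow> u < m \<and> v < m \<and>
    (v = Suc u \<or> u = Suc v \<or> (u = m - 1 \<and> v = 0) \<or> (u = 0 \<and> v = m - 1))"
proof -
  have "v = (u + 1) mod m \<longleftrightarrow> v = Suc u \<or> (u = m - 1 \<and> v = 0)" if "u < m" "v < m" for u v
    using that by (cases "u = m - 1") auto
  from this[of u v] this[of v u] show ?thesis
    unfolding cycle_graph_def by (auto simp del: mod_less)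
qed

lemma pverts_cycle_graph: "pverts (cycle_graph m) = {0..<m}"
  by (simp add: cycle_graph_def)

lemma pair_graph_cycle_graph:
  assumes "m \<ge> 3"
  shows "pair_graph (cycle_graph m)"
  using assms by (intro pair_graphI) (auto simp: pverts_cycle_graph cycle_graph_arc_iff)

lemma connected_cycle_graph:
  assumes "m \<ge> 3"
  shows "Digraph_Component.connected (with_proj (cycle_graph m))"
proof -
  interpret pair_graph "cycle_graph m" by (rule pair_graph_cycle_graph[OF assms])
  have from0: "0 \<rightarrow>\<^sup>*\<^bsub>with_proj (cycle_graph m)\<^esub> u" if "u < m" for u
    using that
  proof (induction u)
    case 0
    then show ?case by (simp add: pverts_cycle_graph)
  next
    case (Suc u)
    then have "(u, Suc u) \<in> parcs (cycle_graph m)"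
      using assms by (simp add: cycle_graph_arc_iff)
    then show ?case using Suc reachable_adj_trans by auto
  qed
  have "u \<rightarrow>\<^sup>*\<^bsub>with_proj (cycle_graph m)\<^esub> v" if "u < m" "v < m" for u v
    using that from0 reachable_trans symmetric_reachable[OF pair_sym_arcs] by blast
  then show ?thesis
    unfolding connected_def strongly_connected_def
    using assms by (auto simp: pverts_cycle_graph reachable_mk_symmetric_eq[OF pair_sym_arcs])
qed

lemma out_degree_cycle_graph:
  assumes "m \<ge> 3" "u < m"
  shows "out_degree (with_proj (cycle_graph m)) u = 2"
proof -
  have "out_arcs (with_proj (cycle_graph m)) u
      = {(u, if u = m - 1 then 0 else Suc u), (u, if u = 0 then m - 1 else u - 1)}"
    using assms by (auto simp: out_arcs_def cycle_graph_arc_iff)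
  \<comment> \<open>Successor and predecessor are distinct because \<open>m\<close> is at least
    3.\<close>
  moreover have "(if u = m - 1 then 0 else Suc u) \<noteq> (if u = 0 then m - 1 else u - 1)"
    using assms by auto
  ultimately show ?thesis unfolding out_degree_def by simp
qed

lemma regular_cycle_graph:
  assumes "m \<ge> 3"
  shows "regular (cycle_graph m)"
  using out_degree_cycle_graph[OF assms] by (auto simp: regular_def pverts_cycle_graph)

lemma edge_iso_cycle_graph_2_le:
  assumes "m \<ge> 3"
  shows "edge_iso (cycle_graph m) 2 \<le> 1"
proof -
  note G = pair_graph_cycle_graph[OF assms]
  \<comment> \<open>The only exits from the path on 0 and 1 go from 1 up to 2 and from 0 back to
    \<open>m - 1\<close>.\<close>
  have "{(u, v) \<in> parcs (cycle_graph m). u \<in> {0, 1} \<and> v \<notin> {0, 1}} \<subseteq> {(1, 2), (0, m - 1)}"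
    using assms by (auto simp: cycle_graph_arc_iff)
  then have "cut_size (cycle_graph m) {0, 1} \<le> card {(1 :: nat, 2 :: nat), (0, m - 1)}"
    unfolding cut_size_eq_card_arcs[OF G] by (intro card_mono) simp
  then have "cut_size (cycle_graph m) {0, 1} \<le> 2" by simp
  moreover have "edge_iso (cycle_graph m) (card {0, 1 :: nat})
      \<le> real (cut_size (cycle_graph m) {0, 1}) / real (card {0, 1 :: nat})"
    using assms by (intro edge_iso_le) (auto simp: pverts_cycle_graph)
  ultimately show ?thesis by (simp add: numeral_2_eq_2)
qed

lemma not_affine_on_psi_cycle_graph:
  assumes "m \<ge> 5"
  shows "\<not> affine_on {0..ln (real m)} (psi (cycle_graph m))"
proof (rule not_affine_on_psi)
  have m: "m \<ge> 3" using assms by simp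
  show "pair_graph (cycle_graph m)" by (rule pair_graph_cycle_graph[OF m])
  have "edge_iso (cycle_graph m) 1 = real 2"
    using m out_degree_cycle_graph[OF m]
    by (intro edge_iso_1[OF pair_graph_cycle_graph]) (auto simp: pverts_cycle_graph)
  \<comment> \<open>This says \<open>m > 4\<close>; it is exactly the condition for the chord from
    \<open>(0, 2)\<close> to exceed 1 at log 2.\<close>
  moreover have "2 * ln 2 < ln (real m)"
  proof -
    have "2 * ln 2 = ln (4 :: real)" using ln_realpow[of 2 2] by simp
    also have "\<dots> < ln (real m)" using assms by (subst ln_less_cancel_iff) auto
    finally show ?thesis .
  qed
  then have "1 < 2 * (1 - ln 2 / ln (real m))"
    using assms by (simp add: field_simps)
  ultimately show "edge_iso (cycle_graph m) 2
      < edge_iso (cycle_graph m) 1 * (1 - ln (real 2) / ln (real m))"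
    using edge_iso_cycle_graph_2_le[OF m] by simp
  show "card (pverts (cycle_graph m)) = m" by (simp add: pverts_cycle_graph)
  show "2 \<in> {1..m}" "m \<ge> 2" using assms by simp_all
qed

theorem mainTheorem5:
  shows "(\<forall>G :: 'a pair_pre_digraph. \<forall>m :: nat.
            pair_graph G \<and> Digraph_Component.connected (with_proj G) \<and> regular G \<and>
            card (pverts G) = m \<and> m \<ge> 2 \<and> \<not> affine_on {0..ln (real m)} (psi G) \<longrightarrow>
            (\<forall>n \<ge> 1. \<not> (\<exists>c C :: real. \<forall>a \<in> {1..m ^ n}.
               edge_iso (graph_power G n) a = c * ln (real (m ^ n) / real a) + C)))
       \<and> (\<exists>G :: nat pair_pre_digraph.
            pair_graph G \<and> Digraph_Component.connected (with_proj G) \<and> regular G \<and>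
            \<not> affine_on {0..ln (real (card (pverts G)))} (psi G))
       \<and> (\<forall>m \<ge> 5. pair_graph (cycle_graph m) \<and> card (pverts (cycle_graph m)) = m \<and>
            Digraph_Component.connected (with_proj (cycle_graph m)) \<and> regular (cycle_graph m) \<and>
            \<not> affine_on {0..ln (real m)} (psi (cycle_graph m)))"
proof (intro conjI allI impI)
  fix G :: "'a pair_pre_digraph" and m n :: nat
  assume "pair_graph G \<and> Digraph_Component.connected (with_proj G) \<and> regular G \<and>
    card (pverts G) = m \<and> m \<ge> 2 \<and> \<not> affine_on {0..ln (real m)} (psi G)" "n \<ge> 1"
  then show "\<not> (\<exists>c C :: real. \<forall>a \<in> {1..m ^ n}.
      edge_iso (graph_power G n) a = c * ln (real (m ^ n) / real a) + C)"
    by (metis edge_iso_graph_power_not_linear)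
next
  show "\<exists>G :: nat pair_pre_digraph.
      pair_graph G \<and> Digraph_Component.connected (with_proj G) \<and> regular G \<and>
      \<not> affine_on {0..ln (real (card (pverts G)))} (psi G)"
    using pair_graph_cycle_graph[of 5] connected_cycle_graph[of 5] regular_cycle_graph[of 5]
      not_affine_on_psi_cycle_graph[of 5]
    by (intro exI[of _ "cycle_graph 5"] conjI) (simp_all only: pverts_cycle_graph card_atLeastLessThan, simp_all)
qed (simp_all add: pair_graph_cycle_graph connected_cycle_graph regular_cycle_graph
  not_affine_on_psi_cycle_graph pverts_cycle_graph)

end
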